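(* Let $p\ge 2$ be an integer. The generating function of the size (number of edges) of $\Gamma_n^{(p)}$ is $$\sum_{n\geq 0}|E(\Gamma^{(p)}_{n})|\,t^n=\frac{t+2t^2+\dots+(p-1)t^{p-1}}{(1-t-t^2-\dots-t^{p})^2},$$ as an identity of formal power series in $t$.
   Context: For an integer $n\ge 0$, the hypercube $Q_n$ has vertex set $\{0,1\}^n$ (binary strings of length $n$; for $n=0$ only the empty string), two strings being adjacent iff they differ in exactly one coordinate. For $p\ge2$, a $p$-th order Fibonacci string is a binary string that does not contain $1^p$ ($p$ consecutive 1s) as a substring (of consecutive letters). $\Gamma_n^{(p)}$ is the subgraph of $Q_n$ induced by the $p$-th order Fibonacci strings of length $n$; in particular $\Gamma_0^{(p)}=K_1$. $E(G)$ denotes the edge set of a graph $G$. *)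

theory Defs
  imports
    "HOL-Library.Sublist"
    "HOL-Computational_Algebra.Formal_Power_Series"
begin

text \<open>A simple graph is represented as a pair of a vertex set and a set of undirected edges,
  an edge being the two-element set of its endpoints.\<close>

type_synonym 'a sgraph = "'a set \<times> 'a set set"

abbreviation verts :: "'a sgraph \<Rightarrow> 'a set" where
  "verts \<equiv> fst"

abbreviation edges :: "'a sgraph \<Rightarrow> 'a set set" where
  "edges \<equiv> snd"

definition induced_subgraph :: "'a sgraph \<Rightarrow> 'a set \<Rightarrow> 'a sgraph" where
  "induced_subgraph G S = (verts G \<inter> S, {e \<in> edges G. e \<subseteq> S})"

text \<open>Binary strings are lists of truth values, with \<^const>\<open>True\<close> for the letter 1.\<close>

definition binary_strings :: "nat \<Rightarrow> bool list set" where
  "binary_strings n = {w. length w = n}"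

definition hypercube :: "nat \<Rightarrow> bool list sgraph" where
  "hypercube n =
     (binary_strings n,
      {{u, v} | u v. u \<in> binary_strings n \<and> v \<in> binary_strings n \<and>
                     card {i. i < n \<and> u ! i \<noteq> v ! i} = 1})"

text \<open>In the library, \<^const>\<open>sublist\<close> means contiguous sublist, unlike \<^const>\<open>subseq\<close>.\<close>

definition fibonacci_string :: "nat \<Rightarrow> bool list \<Rightarrow> bool" where
  "fibonacci_string p w \<longleftrightarrow> \<not> sublist (replicate p True) w"

definition fibonacci_cube :: "nat \<Rightarrow> nat \<Rightarrow> bool list sgraph" where
  "fibonacci_cube p n =
     induced_subgraph (hypercube n) {w \<in> binary_strings n. fibonacci_string p w}"

end

theory Submission
  imports Defs
begin

text \<open>
  An edge of \<^term>\<open>fibonacci_cube p n\<close> joins a string to the string obtained from it by turning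
  one letter 1 into 0. Lowering a letter never creates a run of 1s, so every letter 1 of every
  Fibonacci string gives an edge, and the number of edges is the total number of 1s in all
  Fibonacci strings of length \<open>n\<close> (\<open>card_edges_fibonacci_cube\<close>).

  These 1s are counted by cutting a string at its first 0: a Fibonacci string is either
  \<open>1\<^sup>a\<close> or \<open>1\<^sup>a 0 w\<close>, where \<open>a < p\<close> and \<open>w\<close> is again an arbitrary Fibonacci string. Put
  \<open>S = \<Sum>a<p. X\<^sup>a\<close> and \<open>A = \<Sum>a<p. a X\<^sup>a\<close>, let \<open>F\<close> be the generating function of the number of
  Fibonacci strings and \<open>W\<close> that of their 1s. The cut (\<open>string_gf_first_zero\<close>) gives
  \<open>F = S + X S F\<close> and \<open>W = A + X (A F + S W)\<close>. By the first equation \<open>(1 - X S) (1 + X F) = 1\<close>,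
  by the second \<open>(1 - X S) W = A (1 + X F)\<close>; hence \<open>(1 - X S)\<^sup>2 W = A\<close>.
  Here \<open>X S = X + \<dots> + X\<^sup>p\<close>, and the term with \<open>a = 0\<close> drops out of \<open>A\<close>.
\<close>

section \<open>Edges and letters 1\<close>

definition fibonacci_strings :: "nat \<Rightarrow> nat \<Rightarrow> bool list set" where
  "fibonacci_strings p n = {w \<in> binary_strings n. fibonacci_string p w}"

lemma finite_fibonacci_strings: "finite (fibonacci_strings p n)"
proof (rule finite_subset)
  show "fibonacci_strings p n \<subseteq> {w. set w \<subseteq> UNIV \<and> length w = n}"
    by (auto simp: fibonacci_strings_def binary_strings_def)
  show "finite {w :: bool list. set w \<subseteq> UNIV \<and> length w = n}"
    by (rule finite_lists_length_eq) simp
qed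

lemma sublist_replicate_iff_nth:
  "sublist (replicate m x) w \<longleftrightarrow> (\<exists>k. k + m \<le> length w \<and> (\<forall>j<m. w ! (k + j) = x))"
proof
  assume "sublist (replicate m x) w"
  then obtain us vs where w: "w = us @ replicate m x @ vs"
    by (auto simp: sublist_def)
  have "length us + m \<le> length w \<and> (\<forall>j<m. w ! (length us + j) = x)"
    by (auto simp: w nth_append)
  then show "\<exists>k. k + m \<le> length w \<and> (\<forall>j<m. w ! (k + j) = x)" ..
next
  assume "\<exists>k. k + m \<le> length w \<and> (\<forall>j<m. w ! (k + j) = x)"
  then obtain k where k: "k + m \<le> length w" "\<forall>j<m. w ! (k + j) = x" by blast
  have "take m (drop k w) = replicate m x"
    using k by (intro nth_equalityI) auto
  then have "w = take k w @ replicate m x @ drop m (drop k w)"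
    by (metis append_take_drop_id)
  then show "sublist (replicate m x) w"
    by (auto simp: sublist_def)
qed

lemma fibonacci_string_lower_letter:
  assumes "fibonacci_string p w"
  shows "fibonacci_string p (w[i := False])"
proof -
  have below: "w ! j" if "w[i := False] ! j" "j < length w" for j
    using that by (cases "i = j") auto
  have "sublist (replicate p True) w" if low: "sublist (replicate p True) (w[i := False])"
  proof -
    obtain k where k: "k + p \<le> length w" "\<And>j. j < p \<Longrightarrow> w[i := False] ! (k + j)"
      using low by (auto simp: sublist_replicate_iff_nth)
    have "w ! (k + j)" if "j < p" for j
      using k that below by simp
    then show ?thesis
      using k(1) by (auto simp: sublist_replicate_iff_nth)
  qed
  then show ?thesis
    using assms by (auto simp: fibonacci_string_def)
qed

text \<open>The 1 at the only position where the two endpoints differ tells which endpoint is the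
  upper one, so each edge comes from exactly one letter.\<close>

lemma bij_betw_ones_edges:
  "bij_betw (\<lambda>(w, i). {w, w[i := False]})
     (SIGMA w:fibonacci_strings p n. {i. i < n \<and> w ! i})
     (edges (fibonacci_cube p n))"
proof -
  let ?h = "\<lambda>(w :: bool list, i). {w, w[i := False]}"
  let ?O = "SIGMA w:fibonacci_strings p n. {i. i < n \<and> w ! i}"
  have inj: "inj_on ?h ?O"
  proof (rule inj_onI, clarify)
    fix w i w' j
    assume w: "w \<in> fibonacci_strings p n" "i < n" "w ! i"
      and w': "w' \<in> fibonacci_strings p n" "j < n" "w' ! j"
      and eq: "{w, w[i := False]} = {w', w'[j := False]}"
    have len: "length w = n" "length w' = n"
      using w w' by (auto simp: fibonacci_strings_def binary_strings_def)
    \<comment> \<open>The other matching of the endpoints would make each string lie below the other.\<close>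
    have "w = w'"
    proof (rule ccontr)
      assume "w \<noteq> w'"
      then have "w = w'[j := False]" "w' = w[i := False]"
        using eq by (auto simp: doubleton_eq_iff)
      then show False
        using w w' len by (metis nth_list_update)
    qed
    moreover have "w[i := False] = w'[j := False]"
      using eq \<open>w = w'\<close> by (auto simp: doubleton_eq_iff)
    then have "i = j"
      using w w' len \<open>w = w'\<close> by (metis nth_list_update)
    ultimately show "w = w' \<and> i = j" by simp
  qed
  have "?h ` ?O \<subseteq> edges (fibonacci_cube p n)"
  proof clarify
    fix w i
    assume w: "w \<in> fibonacci_strings p n" "i < n" "w ! i"
    then have len: "length w = n"
      by (simp add: fibonacci_strings_def binary_strings_def)
    have "{k. k < n \<and> w ! k \<noteq> w[i := False] ! k} = {i}"
      using w len by (auto simp: nth_list_update)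
    then have "card {k. k < n \<and> w ! k \<noteq> w[i := False] ! k} = 1" by simp
    then have "{w, w[i := False]} \<in> edges (hypercube n)"
      using len unfolding hypercube_def binary_strings_def snd_conv
      by (intro CollectI exI[of _ w] exI[of _ "w[i := False]"]) auto
    moreover have "{w, w[i := False]} \<subseteq> fibonacci_strings p n"
      using w fibonacci_string_lower_letter
      by (auto simp: fibonacci_strings_def binary_strings_def)
    ultimately show "{w, w[i := False]} \<in> edges (fibonacci_cube p n)"
      by (simp add: fibonacci_cube_def induced_subgraph_def fibonacci_strings_def)
  qed
  moreover have "edges (fibonacci_cube p n) \<subseteq> ?h ` ?O"
  proof
    fix e
    assume e: "e \<in> edges (fibonacci_cube p n)"
    then obtain u v where uv: "e = {u, v}"
        "card {i. i < n \<and> u ! i \<noteq> v ! i} = 1"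
      by (auto simp: fibonacci_cube_def induced_subgraph_def hypercube_def)
    have fib: "u \<in> fibonacci_strings p n" "v \<in> fibonacci_strings p n"
      using e uv by (auto simp: fibonacci_cube_def induced_subgraph_def fibonacci_strings_def)
    then have len: "length u = n" "length v = n"
      by (auto simp: fibonacci_strings_def binary_strings_def)
    obtain i where i: "{i. i < n \<and> u ! i \<noteq> v ! i} = {i}"
      using uv(2) by (auto simp: card_1_singleton_iff)
    then have "i < n" "u ! i \<noteq> v ! i" by blast+
    have same: "u ! k = v ! k" if "k < n" "k \<noteq> i" for k
      using i that by blast
    show "e \<in> ?h ` ?O"
    proof (cases "u ! i")
      case True
      have "v ! k = u[i := False] ! k" if "k < n" for k
        using len \<open>u ! i \<noteq> v ! i\<close> same True that by (cases "k = i") auto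
      then have "v = u[i := False]"
        using len by (intro nth_equalityI) auto
      then have "e = ?h (u, i)" "(u, i) \<in> ?O"
        using uv fib True \<open>i < n\<close> by auto
      then show ?thesis by (rule image_eqI)
    next
      case False
      have "u ! k = v[i := False] ! k" if "k < n" for k
        using len \<open>u ! i \<noteq> v ! i\<close> same False that by (cases "k = i") auto
      then have "u = v[i := False]"
        using len by (intro nth_equalityI) auto
      then have "e = ?h (v, i)" "(v, i) \<in> ?O"
        using uv fib False \<open>i < n\<close> \<open>u ! i \<noteq> v ! i\<close> by auto
      then show ?thesis by (rule image_eqI)
    qed
  qed
  ultimately show ?thesis
    using inj by (simp add: bij_betw_def subset_antisym)
qed

lemma card_edges_fibonacci_cube:
  "card (edges (fibonacci_cube p n)) = (\<Sum>w\<in>fibonacci_strings p n. count_list w True)"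
proof -
  have "card (edges (fibonacci_cube p n)) =
        card (SIGMA w:fibonacci_strings p n. {i. i < n \<and> w ! i})"
    by (rule bij_betw_same_card[OF bij_betw_ones_edges, symmetric])
  also have "\<dots> = (\<Sum>w\<in>fibonacci_strings p n. card {i. i < n \<and> w ! i})"
    by (rule card_SigmaI) (simp_all add: finite_fibonacci_strings)
  also have "\<dots> = (\<Sum>w\<in>fibonacci_strings p n. count_list w True)"
  proof (rule sum.cong)
    fix w
    assume "w \<in> fibonacci_strings p n"
    then have "length w = n"
      by (simp add: fibonacci_strings_def binary_strings_def)
    then show "card {i. i < n \<and> w ! i} = count_list w True"
      by (simp add: count_list_eq_length_filter length_filter_conv_card)
  qed simp
  finally show ?thesis .
qed

section \<open>Cutting a string at its first 0\<close>

lemma fibonacci_string_replicate_True_iff: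
  "fibonacci_string p (replicate a True) \<longleftrightarrow> a < p"
proof -
  have "sublist (replicate p True) (replicate a True) \<longleftrightarrow> p \<le> a"
    unfolding sublist_replicate_iff_nth by (auto intro: exI[of _ 0])
  then show ?thesis by (auto simp: fibonacci_string_def)
qed

text \<open>No run of 1s crosses the 0, so the runs before and after it can be bounded
  separately.\<close>

lemma fibonacci_string_first_zero_iff:
  "fibonacci_string p (replicate a True @ False # w) \<longleftrightarrow> a < p \<and> fibonacci_string p w"
proof (cases "a < p")
  case True
  have "sublist (replicate p True) (replicate a True @ False # w) \<longleftrightarrow>
        sublist (replicate p True) w"
    using True
  proof (induction a)
    case 0
    then show ?case by (cases p) (auto simp: sublist_Cons_right)
  next
    case (Suc a)
    \<comment> \<open>A run of \<open>p\<close> letters 1 at the start would cover the 0 at position \<open>Suc a < p\<close>.\<close>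
    have "\<not> prefix (replicate p True) (replicate (Suc a) True @ False # w)"
    proof
      assume "prefix (replicate p True) (replicate (Suc a) True @ False # w)"
      then obtain zs where "replicate (Suc a) True @ False # w = replicate p True @ zs"
        by (auto simp: prefix_def)
      then have "(replicate (Suc a) True @ False # w) ! Suc a = (replicate p True @ zs) ! Suc a"
        by (rule arg_cong)
      then show False
        using Suc.prems by (simp add: nth_append)
    qed
    then show ?case
      using Suc by (simp add: sublist_Cons_right)
  qed
  then show ?thesis
    using True by (simp add: fibonacci_string_def)
next
  case False
  then have "replicate a True = replicate p True @ replicate (a - p) True"
    by (simp add: replicate_add[symmetric])
  then have "prefix (replicate p True) (replicate a True @ False # w)"
    by simp
  then show ?thesis
    using False by (auto simp: fibonacci_string_def)
qed

lemma bool_list_first_zero_cases: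
  obtains (all_ones) "w = replicate (length w) True"
  | (first_zero) a v where "w = replicate a True @ False # v"
proof (induction w arbitrary: thesis)
  case Nil
  then show ?case by simp
next
  case (Cons x w)
  show ?case
  proof (cases x)
    case False
    then show ?thesis using Cons.prems(2)[of 0 w] by simp
  next
    case True
    show ?thesis
    proof (rule Cons.IH)
      assume "w = replicate (length w) True"
      then show ?thesis using True Cons.prems(1) by simp
    next
      fix a v
      assume "w = replicate a True @ False # v"
      then show ?thesis using True Cons.prems(2)[of "Suc a" v] by simp
    qed
  qed
qed

lemma first_zero_unique:
  assumes "replicate a True @ False # v = replicate b True @ False # w"
  shows "a = b"
proof -
  have "length (takeWhile id (replicate c True @ False # u)) = c" for c u
    by (induction c) auto
  then show ?thesis using assms by metis
qed

lemma fibonacci_strings_first_zero: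
  "fibonacci_strings p n =
     {w. w = replicate n True \<and> n < p} \<union>
     (\<Union>a\<in>{a. a < p \<and> a < n}.
        (\<lambda>w. replicate a True @ False # w) ` fibonacci_strings p (n - Suc a))"
  (is "_ = ?A \<union> ?B")
proof (intro equalityI subsetI)
  fix w
  assume "w \<in> fibonacci_strings p n"
  then have w: "length w = n" "fibonacci_string p w"
    by (auto simp: fibonacci_strings_def binary_strings_def)
  show "w \<in> ?A \<union> ?B"
  proof (cases w rule: bool_list_first_zero_cases)
    case all_ones
    then have "w = replicate n True"
      using w by simp
    then show ?thesis
      using w(2) by (simp add: fibonacci_string_replicate_True_iff)
  next
    case (first_zero a v)
    then have "a < p" "a < n" "v \<in> fibonacci_strings p (n - Suc a)"
      using w by (auto simp: fibonacci_string_first_zero_iff fibonacci_strings_def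
          binary_strings_def)
    then show ?thesis using first_zero by blast
  qed
next
  fix w
  assume "w \<in> ?A \<union> ?B"
  then show "w \<in> fibonacci_strings p n"
    by (auto simp: fibonacci_strings_def binary_strings_def
        fibonacci_string_first_zero_iff fibonacci_string_replicate_True_iff)
qed

lemma sum_fibonacci_strings_first_zero:
  fixes g :: "bool list \<Rightarrow> 'a :: comm_monoid_add"
  shows "(\<Sum>w\<in>fibonacci_strings p n. g w) =
     (if n < p then g (replicate n True) else 0) +
     (\<Sum>a | a < p \<and> a < n.
        \<Sum>w\<in>fibonacci_strings p (n - Suc a). g (replicate a True @ False # w))"
proof -
  let ?c = "\<lambda>a w. replicate a True @ False # w"
  let ?A = "{w. w = replicate n True \<and> n < p}"
  let ?B = "\<Union>a\<in>{a. a < p \<and> a < n}. ?c a ` fibonacci_strings p (n - Suc a)"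
  have "False \<in> set w" if "w \<in> ?B" for w
    using that by auto
  then have disj: "?A \<inter> ?B = {}"
    by fastforce
  have "sum g (fibonacci_strings p n) = sum g ?A + sum g ?B"
    unfolding fibonacci_strings_first_zero[of p n]
    by (rule sum.union_disjoint[OF _ _ disj]) (simp_all add: finite_fibonacci_strings)
  also have "sum g ?A = (if n < p then g (replicate n True) else 0)"
    by simp
  also have "sum g ?B =
      (\<Sum>a | a < p \<and> a < n. sum g (?c a ` fibonacci_strings p (n - Suc a)))"
    by (rule sum.UNION_disjoint) (auto simp: finite_fibonacci_strings dest: first_zero_unique)
  also have "\<dots> = (\<Sum>a | a < p \<and> a < n. \<Sum>w\<in>fibonacci_strings p (n - Suc a). g (?c a w))"
    by (intro sum.cong refl sum.reindex_cong[where l = "?c _"]) (auto intro: inj_onI)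
  finally show ?thesis .
qed

section \<open>Generating functions\<close>

definition string_gf :: "nat \<Rightarrow> (bool list \<Rightarrow> 'a :: comm_ring_1) \<Rightarrow> 'a fps" where
  "string_gf p g = Abs_fps (\<lambda>n. \<Sum>w\<in>fibonacci_strings p n. g w)"

text \<open>The weight \<open>g\<close> is arbitrary so that the number of strings and the number of their 1s, whose
  recurrences are intertwined, both come from this one equation.\<close>

lemma string_gf_first_zero:
  "string_gf p g =
     (\<Sum>a<p. fps_const (g (replicate a True)) * fps_X ^ a) +
     (\<Sum>a<p. fps_X ^ Suc a * string_gf p (\<lambda>w. g (replicate a True @ False # w)))"
proof (rule fps_ext)
  fix n
  have "fps_nth (\<Sum>a<p. fps_const (g (replicate a True)) * fps_X ^ a) n =
        (\<Sum>a<p. if n = a then g (replicate a True) else 0)"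
    unfolding fps_sum_nth by (rule sum.cong) (auto simp: fps_X_power_nth)
  also have "\<dots> = (if n < p then g (replicate n True) else 0)"
    by simp
  finally have ones: "fps_nth (\<Sum>a<p. fps_const (g (replicate a True)) * fps_X ^ a) n =
        (if n < p then g (replicate n True) else 0)" .
  have "fps_nth (\<Sum>a<p. fps_X ^ Suc a * string_gf p (\<lambda>w. g (replicate a True @ False # w))) n =
        (\<Sum>a<p. if a < n then \<Sum>w\<in>fibonacci_strings p (n - Suc a).
           g (replicate a True @ False # w) else 0)"
    unfolding fps_sum_nth fps_X_power_mult_nth
    by (intro sum.cong) (auto simp: string_gf_def)
  also have "\<dots> = (\<Sum>a | a < p \<and> a < n. \<Sum>w\<in>fibonacci_strings p (n - Suc a).
           g (replicate a True @ False # w))"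
    by (subst sum.inter_filter[symmetric]) (auto intro!: sum.cong)
  finally show "fps_nth (string_gf p g) n = fps_nth
     ((\<Sum>a<p. fps_const (g (replicate a True)) * fps_X ^ a) +
      (\<Sum>a<p. fps_X ^ Suc a * string_gf p (\<lambda>w. g (replicate a True @ False # w)))) n"
    unfolding fps_add_nth ones
    by (simp add: string_gf_def sum_fibonacci_strings_first_zero[of g p n])
qed

lemma string_gf_add: "string_gf p (\<lambda>w. g w + h w) = string_gf p g + string_gf p h"
  by (simp add: string_gf_def fps_eq_iff sum.distrib)

lemma string_gf_const: "string_gf p (\<lambda>w. c) = fps_const c * string_gf p (\<lambda>w. 1)"
  by (simp add: string_gf_def fps_eq_iff)

lemma count_list_replicate_True: "count_list (replicate a True) True = a"
  by (induction a) auto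

lemma string_gf_count_ones:
  fixes p :: nat
  defines "S \<equiv> \<Sum>a<p. fps_X ^ a :: 'a :: comm_ring_1 fps"
    and "W \<equiv> string_gf p (\<lambda>w. of_nat (count_list w True)) :: 'a fps"
  shows "W * (1 - fps_X * S) ^ 2 = (\<Sum>a<p. of_nat a * fps_X ^ a)"
proof -
  define A where "A = (\<Sum>a<p. of_nat a * fps_X ^ a :: 'a fps)"
  define F where "F = (string_gf p (\<lambda>w. 1) :: 'a fps)"
  have F: "F = S + fps_X * S * F"
    unfolding F_def S_def
    by (subst string_gf_first_zero) (simp add: sum_distrib_left sum_distrib_right mult.assoc)
  have "W = A + (\<Sum>a<p. fps_X ^ Suc a * (of_nat a * F + W))"
    unfolding W_def
    by (subst string_gf_first_zero)
       (simp add: string_gf_add string_gf_const[of p "of_nat _"] count_list_replicate_True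
         A_def F_def fps_of_nat)
  also have "(\<Sum>a<p. fps_X ^ Suc a * (of_nat a * F + W)) = fps_X * (A * F + S * W)"
    by (simp add: A_def S_def sum_distrib_left sum_distrib_right sum.distrib algebra_simps)
  finally have W: "W = A + fps_X * (A * F + S * W)" .
  have inv: "(1 - fps_X * S) * (1 + fps_X * F) = 1"
  proof -
    have "(1 - fps_X * S) * (1 + fps_X * F) = 1 - fps_X * (S + fps_X * S * F) + fps_X * F"
      by (simp add: algebra_simps)
    then show ?thesis using F by simp
  qed
  have "A * (1 + fps_X * F) = A + fps_X * (A * F + S * W) - fps_X * S * W"
    by (simp add: algebra_simps)
  also have "\<dots> = W - fps_X * S * W"
    by (simp only: W[symmetric])
  finally have "W * (1 - fps_X * S) = A * (1 + fps_X * F)"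
    by (simp add: algebra_simps)
  then have "W * (1 - fps_X * S) ^ 2 = A * (1 + fps_X * F) * (1 - fps_X * S)"
    by (simp only: power2_eq_square mult.assoc[symmetric])
  also have "\<dots> = A * ((1 - fps_X * S) * (1 + fps_X * F))"
    by (simp only: ac_simps)
  finally show ?thesis
    by (simp add: inv A_def)
qed

theorem theorem5p2:
  fixes p :: nat
  assumes "p \<ge> 2"
  shows "(Abs_fps (\<lambda>n. of_nat (card (edges (fibonacci_cube p n)))) :: rat fps) =
         (\<Sum>k = 1..p - 1. of_nat k * fps_X ^ k) /
         (1 - (\<Sum>k = 1..p. fps_X ^ k)) ^ 2"
proof -
  let ?W = "string_gf p (\<lambda>w. of_nat (count_list w True)) :: rat fps"
  let ?D = "1 - (\<Sum>k = 1..p. fps_X ^ k) :: rat fps"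
  have XS: "fps_X * (\<Sum>a<p. fps_X ^ a) = (\<Sum>k = 1..p. fps_X ^ k :: rat fps)"
    unfolding sum_distrib_left
    by (rule sum.reindex_bij_witness[of _ "\<lambda>k. k - 1" Suc]) auto
  have A: "(\<Sum>a<p. of_nat a * fps_X ^ a) = (\<Sum>k = 1..p - 1. of_nat k * fps_X ^ k :: rat fps)"
    by (rule sum.mono_neutral_right) auto
  have "?W * ?D ^ 2 = (\<Sum>k = 1..p - 1. of_nat k * fps_X ^ k)"
    using string_gf_count_ones[where 'a = rat, of p] by (simp only: XS A)
  moreover have "fps_nth ?D 0 = 1"
    by (simp add: fps_sum_nth)
  then have "?D ^ 2 \<noteq> 0"
    by auto
  ultimately have "?W = (\<Sum>k = 1..p - 1. of_nat k * fps_X ^ k) / ?D ^ 2"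
    by (metis nonzero_mult_div_cancel_right)
  then show ?thesis
    by (simp add: string_gf_def card_edges_fibonacci_cube)
qed

end
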